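(* Consider the plant $\dot{x}=Ax+Bu+Ed$, $y=Hx$ with $A\in\mathbb{R}^{n\times n}$, a transmission interval $T\in\mathbb{R}_{\ge0}$ and a quantization level $N\in\mathbb{Z}_{>0}$. If $T$ and $N$ satisfy the condition of the norm-based scheme, $$\frac{e^{|A|T}}{N}<1,$$ then the condition of the set-based scheme, $$\max_{i\in\mathcal{I}_n}\left|\lambda_i\left(\frac{\bar{\Lambda}}{N}\right)\right|<1,$$ also holds.
   Context: $x\in\mathbb{R}^n$, $u\in\mathbb{R}^m$, $y\in\mathbb{R}^{n_y}$, $d\in\mathbb{R}^o$; $A,B,E,H$ are real matrices of appropriate dimensions with $(A,H)$ observable. $\mathcal{I}_n=\{1,\dots,n\}$, $\mathbb{Z}_{>0}=\{1,2,\dots\}$. For a matrix $M\in\mathbb{R}^{n\times n}$, $|M|:=\max_{j\in\mathcal{I}_n}\sum_{i=1}^n|m_{ij}|$, and $\lambda_i(M)$, $i\in\mathcal{I}_n$, are its (complex) eigenvalues. $\Lambda:=e^{AT}$ and $\bar{\Lambda}:=(|\Lambda_{ij}|)_{i,j\in\mathcal{I}_n}$ is the entrywise absolute value of $\Lambda$. *)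

theory Defs
  imports "Jordan_Normal_Form.Spectral_Radius"
begin

definition mat_norm :: "real mat \<Rightarrow> real" where
  "mat_norm M = Max ((\<lambda>j. \<Sum>i<dim_row M. \<bar>M $$ (i, j)\<bar>) ` {..<dim_col M})"

definition mat_abs :: "real mat \<Rightarrow> real mat" where
  "mat_abs M = map_mat abs M"

text \<open>The type \<^typ>\<open>real mat\<close> carries no topology (its values may have any dimensions), so
  the exponential series of a square matrix is summed entrywise.\<close>

definition mat_exp :: "real mat \<Rightarrow> real mat" where
  "mat_exp M = mat (dim_row M) (dim_row M) (\<lambda>(i, j). \<Sum>k. (M ^\<^sub>m k) $$ (i, j) / fact k)"

text \<open>\<open>x\<close> solves \<open>x' = A x\<close> on \<open>[0, \<infinity>)\<close>; the derivative is taken componentwise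
  and is one-sided at \<open>0\<close>.\<close>

definition unforced_solution :: "real mat \<Rightarrow> (real \<Rightarrow> real vec) \<Rightarrow> bool" where
  "unforced_solution A x \<longleftrightarrow>
     (\<forall>t\<ge>0. x t \<in> carrier_vec (dim_row A) \<and>
       (\<forall>i<dim_row A.
          ((\<lambda>s. x s $ i) has_real_derivative (A *\<^sub>v x t) $ i) (at t within {0..})))"

text \<open>Observability of the pair \<open>(A, H)\<close>: the output \<open>y = H x\<close> of the unforced system
  determines the initial state.\<close>

definition observable :: "real mat \<Rightarrow> real mat \<Rightarrow> bool" where
  "observable A H \<longleftrightarrow>
     (\<forall>x x'. unforced_solution A x \<longrightarrow> unforced_solution A x' \<longrightarrow>
        (\<forall>t\<ge>0. H *\<^sub>v x t = H *\<^sub>v x' t) \<longrightarrow> x 0 = x' 0)"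

end

theory Submission
  imports Defs
begin

text \<open>The norm \<open>mat_norm\<close> is the maximal absolute column sum, i.e. the operator norm induced by the
  \<open>\<ell>\<^sub>1\<close> norm on vectors. It is submultiplicative, so summing the exponential series gives
  \<open>|exp (T A)| \<le> exp (T |A|)\<close>. It only sees absolute values of entries, hence is unchanged under
  \<open>mat_abs\<close>, and it dominates the modulus of every eigenvalue: apply the \<open>\<ell>\<^sub>1\<close> norm to both sides of
  \<open>M v = \<lambda> v\<close>.\<close>

text \<open>\<open>Max {}\<close> is unspecified, so at least one column is required. Later bounds
  on \<open>mat_norm\<close> then reduce to bounding one column at a time.\<close>

lemma mat_norm_le_iff:
  assumes "0 < dim_col M"
  shows "mat_norm M \<le> c \<longleftrightarrow> (\<forall>j<dim_col M. (\<Sum>i<dim_row M. \<bar>M $$ (i, j)\<bar>) \<le> c)"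
  using assms unfolding mat_norm_def by (subst Max_le_iff) (auto simp: lessThan_empty_iff)

lemma col_sum_le_mat_norm:
  assumes "j < dim_col M"
  shows "(\<Sum>i<dim_row M. \<bar>M $$ (i, j)\<bar>) \<le> mat_norm M"
  using assms mat_norm_le_iff[of M "mat_norm M"] by simp

lemma mat_norm_nonneg:
  assumes "0 < dim_col M"
  shows "0 \<le> mat_norm M"
  using order_trans[OF sum_nonneg col_sum_le_mat_norm[OF assms]] by simp

lemma abs_entry_le_mat_norm:
  assumes "i < dim_row M" "j < dim_col M"
  shows "\<bar>M $$ (i, j)\<bar> \<le> mat_norm M"
proof -
  have "\<bar>M $$ (i, j)\<bar> \<le> (\<Sum>i<dim_row M. \<bar>M $$ (i, j)\<bar>)"
    using assms by (intro member_le_sum) auto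
  then show ?thesis
    using col_sum_le_mat_norm[OF assms(2)] by linarith
qed

lemma mat_norm_mat_abs:
  "mat_norm (mat_abs M) = mat_norm M"
  unfolding mat_norm_def mat_abs_def by (intro arg_cong[of _ _ Max] image_cong) auto

lemma mat_norm_smult_le:
  assumes "0 < dim_col M" "0 \<le> c"
  shows "mat_norm (c \<cdot>\<^sub>m M) \<le> c * mat_norm M"
  using assms col_sum_le_mat_norm[of _ M]
  by (auto simp: mat_norm_le_iff abs_mult mult_left_mono simp flip: sum_distrib_left)

text \<open>Column \<open>j\<close> of \<open>A * B\<close> combines the columns of \<open>A\<close>
  with weights \<open>B $$ (k, j)\<close>. Each column of \<open>A\<close> contributes at most
  \<open>mat_norm A\<close> times its absolute weight.\<close>

lemma mat_norm_mult_le: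
  assumes "0 < dim_col B" "dim_col A = dim_row B"
  shows "mat_norm (A * B) \<le> mat_norm A * mat_norm B"
proof -
  have "(\<Sum>i<dim_row A. \<bar>(A * B) $$ (i, j)\<bar>) \<le> mat_norm A * mat_norm B" if j: "j < dim_col B" for j
  proof -
    have "(\<Sum>i<dim_row A. \<bar>(A * B) $$ (i, j)\<bar>)
        \<le> (\<Sum>i<dim_row A. \<Sum>k<dim_row B. \<bar>A $$ (i, k)\<bar> * \<bar>B $$ (k, j)\<bar>)"
      using j assms(2)
      by (intro sum_mono)
        (auto simp: scalar_prod_def atLeast0LessThan simp flip: abs_mult intro!: sum_abs)
    also have "\<dots> = (\<Sum>k<dim_row B. (\<Sum>i<dim_row A. \<bar>A $$ (i, k)\<bar>) * \<bar>B $$ (k, j)\<bar>)"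
      by (subst sum.swap) (simp add: sum_distrib_right)
    also have "\<dots> \<le> (\<Sum>k<dim_row B. mat_norm A * \<bar>B $$ (k, j)\<bar>)"
      using assms(2) by (intro sum_mono mult_right_mono col_sum_le_mat_norm) auto
    also have "\<dots> = mat_norm A * (\<Sum>k<dim_row B. \<bar>B $$ (k, j)\<bar>)"
      by (simp add: sum_distrib_left)
    also have "\<dots> \<le> mat_norm A * mat_norm B"
    \<comment> \<open>With inner dimension 0, \<open>mat_norm A\<close> is the unspecified
      \<open>Max {}\<close> and its sign is unknown. But \<open>mat_norm B\<close> is 0 then, so
      both sides vanish.\<close>
    proof (cases "dim_row B = 0")
      case True
      then show ?thesis
        using assms(1) by (auto simp: mat_norm_def[of B] image_constant_conv lessThan_empty_iff)
    next
      case False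
      then show ?thesis
        using assms(2) j by (intro mult_left_mono col_sum_le_mat_norm mat_norm_nonneg) auto
    qed
    finally show ?thesis .
  qed
  then show ?thesis
    using assms(1) by (simp add: mat_norm_le_iff)
qed

lemma mat_norm_pow_le:
  assumes "M \<in> carrier_mat n n" "0 < n"
  shows "mat_norm (M ^\<^sub>m k) \<le> mat_norm M ^ k"
proof (induction k)
  case 0
  then show ?case
    using assms by (auto simp: mat_norm_le_iff one_mat_def if_distrib cong: if_cong)
next
  case (Suc k)
  have "mat_norm (M ^\<^sub>m Suc k) \<le> mat_norm (M ^\<^sub>m k) * mat_norm M"
    using assms pow_carrier_mat[OF assms(1), of k] by (auto intro!: mat_norm_mult_le)
  also have "\<dots> \<le> mat_norm M ^ k * mat_norm M"
    using assms Suc by (intro mult_right_mono mat_norm_nonneg) auto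
  finally show ?case
    by (simp add: mult.commute)
qed

lemma mat_norm_mat_exp_le:
  assumes M: "M \<in> carrier_mat n n" and n: "0 < n"
  shows "mat_norm (mat_exp M) \<le> exp (mat_norm M)"
proof -
  define c where "c = mat_norm M"
  have exp_sums: "(\<lambda>k. c ^ k / fact k) sums exp c"
    using exp_converges[of c] by (simp add: divide_inverse mult.commute)
  have dims: "dim_row M = n" "dim_col M = n"
    using M by auto
  have "(\<Sum>i<n. \<bar>mat_exp M $$ (i, j)\<bar>) \<le> exp c" if j: "j < n" for j
  proof -
    \<comment> \<open>The entrywise bound serves only for absolute convergence. Summing it over a
      column would cost a factor \<open>n\<close>.\<close>
    have entry: "\<bar>(M ^\<^sub>m k) $$ (i, j) / fact k\<bar> \<le> c ^ k / fact k" if "i < n" for i k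
      using abs_entry_le_mat_norm[of i "M ^\<^sub>m k" j] mat_norm_pow_le[OF M n, of k] that j
      by (simp add: dims c_def divide_right_mono cong: if_cong)
    have summ: "summable (\<lambda>k. \<bar>(M ^\<^sub>m k) $$ (i, j) / fact k\<bar>)" if "i < n" for i
      by (rule summable_comparison_test'[OF sums_summable[OF exp_sums], of 0])
        (use entry[OF that] in auto)
    have "(\<Sum>i<n. \<bar>mat_exp M $$ (i, j)\<bar>) = (\<Sum>i<n. \<bar>\<Sum>k. (M ^\<^sub>m k) $$ (i, j) / fact k\<bar>)"
      using M j by (auto simp: mat_exp_def)
    also have "\<dots> \<le> (\<Sum>i<n. \<Sum>k. \<bar>(M ^\<^sub>m k) $$ (i, j) / fact k\<bar>)"
      using summ by (intro sum_mono summable_rabs) auto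
    \<comment> \<open>With the finite sum inside, the whole column sum of each power is bounded at
      once by \<open>c ^ k\<close>.\<close>
    also have "\<dots> = (\<Sum>k. \<Sum>i<n. \<bar>(M ^\<^sub>m k) $$ (i, j) / fact k\<bar>)"
      using summ by (intro suminf_sum[symmetric]) auto
    also have "\<dots> \<le> (\<Sum>k. c ^ k / fact k)"
    proof (rule suminf_le)
      show "(\<Sum>i<n. \<bar>(M ^\<^sub>m k) $$ (i, j) / fact k\<bar>) \<le> c ^ k / fact k" for k
        using col_sum_le_mat_norm[of j "M ^\<^sub>m k"] mat_norm_pow_le[OF M n, of k] j
        by (simp add: dims c_def divide_right_mono flip: sum_divide_distrib cong: if_cong)
      show "summable (\<lambda>k. \<Sum>i<n. \<bar>(M ^\<^sub>m k) $$ (i, j) / fact k\<bar>)"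
        using summ by (intro summable_sum) auto
      show "summable (\<lambda>k. c ^ k / fact k)"
        using exp_sums by (rule sums_summable)
    qed
    also have "\<dots> = exp c"
      using exp_sums by (simp add: sums_iff)
    finally show ?thesis .
  qed
  moreover have "mat_exp M \<in> carrier_mat n n"
    using M by (simp add: mat_exp_def)
  ultimately show ?thesis
    using n by (auto simp: mat_norm_le_iff c_def)
qed

lemma norm_eigenvalue_le_mat_norm:
  assumes M: "M \<in> carrier_mat n n" and ev: "eigenvalue (map_mat complex_of_real M) \<mu>"
  shows "norm \<mu> \<le> mat_norm M"
proof -
  let ?C = "map_mat complex_of_real M"
  obtain v where v: "v \<in> carrier_vec n" "v \<noteq> 0\<^sub>v n" and eq: "?C *\<^sub>v v = \<mu> \<cdot>\<^sub>v v"
    using ev M by (auto simp: eigenvalue_def eigenvector_def)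
  let ?S = "\<Sum>j<n. norm (v $ j)"
  have "norm \<mu> * ?S = (\<Sum>i<n. norm ((?C *\<^sub>v v) $ i))"
    using v eq by (simp add: norm_mult sum_distrib_left)
  also have "\<dots> \<le> (\<Sum>i<n. \<Sum>j<n. \<bar>M $$ (i, j)\<bar> * norm (v $ j))"
    using M v
    by (intro sum_mono)
      (auto simp: scalar_prod_def atLeast0LessThan norm_mult intro!: sum_norm_le)
  \<comment> \<open>Exchanging the sums turns the rows of the matrix-vector product into column sums
    of \<open>M\<close>, which \<open>mat_norm\<close> controls.\<close>
  also have "\<dots> = (\<Sum>j<n. (\<Sum>i<n. \<bar>M $$ (i, j)\<bar>) * norm (v $ j))"
    by (subst sum.swap) (simp add: sum_distrib_right)
  also have "\<dots> \<le> (\<Sum>j<n. mat_norm M * norm (v $ j))"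
    using M col_sum_le_mat_norm[of _ M] by (intro sum_mono mult_right_mono) auto
  also have "\<dots> = mat_norm M * ?S"
    by (simp add: sum_distrib_left)
  finally have le: "norm \<mu> * ?S \<le> mat_norm M * ?S" .
  \<comment> \<open>An eigenvector is nonzero, so \<open>?S\<close> is positive and cancels.\<close>
  obtain j where "j < n" "v $ j \<noteq> 0"
    using v by (metis carrier_vecD eq_vecI index_zero_vec)
  then have "0 < ?S"
    by (intro sum_pos2[of _ j]) auto
  with le show ?thesis
    by simp
qed

text \<open>Over the complex numbers a matrix of positive dimension has an eigenvalue, so the
  maximum defining the spectral radius is attained by one.\<close>

lemma spectral_radius_le_mat_norm:
  assumes "M \<in> carrier_mat n n" "0 < n"
  shows "spectral_radius (map_mat complex_of_real M) \<le> mat_norm M"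
  using spectral_radius_mem_max(1)[of "map_mat complex_of_real M" n] assms
    norm_eigenvalue_le_mat_norm[OF assms(1)]
  by (auto simp: spectrum_def)

theorem proposition1:
  fixes A B E H :: "real mat" and n m n\<^sub>y l :: nat and T :: real and N :: nat
  assumes "0 < n"
    and "A \<in> carrier_mat n n"
    and "B \<in> carrier_mat n m"
    and "E \<in> carrier_mat n l"
    and "H \<in> carrier_mat n\<^sub>y n"
    and "observable A H"
    and "0 \<le> T"
    and "0 < N"
    and "exp (mat_norm A * T) / real N < 1"
  shows "spectral_radius
           (map_mat complex_of_real
             ((1 / real N) \<cdot>\<^sub>m mat_abs (mat_exp (T \<cdot>\<^sub>m A)))) < 1"
proof -
  let ?L = "mat_abs (mat_exp (T \<cdot>\<^sub>m A))"
  have TA: "T \<cdot>\<^sub>m A \<in> carrier_mat n n"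
    using assms(2) by simp
  then have L: "?L \<in> carrier_mat n n"
    by (auto simp: mat_abs_def mat_exp_def)
  have "spectral_radius (map_mat complex_of_real ((1 / real N) \<cdot>\<^sub>m ?L))
      \<le> mat_norm ((1 / real N) \<cdot>\<^sub>m ?L)"
    using L \<open>0 < n\<close> by (intro spectral_radius_le_mat_norm) auto
  also have "\<dots> \<le> 1 / real N * mat_norm ?L"
    using L \<open>0 < n\<close> by (intro mat_norm_smult_le) auto
  \<comment> \<open>Entrywise absolute values can enlarge the spectral radius but leave
    \<open>mat_norm\<close> fixed, so the bound on the exponential carries over.\<close>
  also have "\<dots> \<le> 1 / real N * exp (mat_norm (T \<cdot>\<^sub>m A))"
    using mat_norm_mat_exp_le[OF TA \<open>0 < n\<close>]
    by (intro mult_left_mono) (auto simp: mat_norm_mat_abs)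
  also have "\<dots> \<le> 1 / real N * exp (mat_norm A * T)"
    using mat_norm_smult_le[of A T] assms(1,2,7)
    by (intro mult_left_mono) (auto simp: mult.commute)
  also have "\<dots> < 1"
    using assms(9) by simp
  finally show ?thesis .
qed

end
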